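(* Let $X$ be a Hausdorff space, let $Z$ be a Hausdorff topological vector space, let $C\subseteq Z$ be a convex and pointed cone with nonempty interior, and let $K$ be a nonempty subset of $X$. If $f,g:K\to Z$ are a-usc at $x_0\in K$, then $f+g$ is a-usc at $x_0$.
   Context: Topological vector spaces are real. A set $C\subseteq Z$ is a cone if $tc\in C$ for all $c\in C$, $t\ge 0$; it is convex if $C+C=C$ and pointed if $C\cap(-C)=\{0\}$. A mapping $h:K\to Z$ is almost upper semicontinuous (a-usc) at $x_0\in K$ if for every net $(x_\alpha)\subseteq K$ with $\lim x_\alpha=x_0$ there exists a net $(z_\alpha)\subseteq Z$ (indexed by the same directed set) with $\lim z_\alpha=z\in Z$ such that $h(x_\alpha)-z_\alpha\in -C$ for all $\alpha$ and $h(x_0)-z\in C$. *)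

theory Defs
  imports "HOL-Analysis.Analysis"
begin

text \<open>Real topological vector spaces; both operations are jointly continuous. The Hausdorff
  property is not part of the class.\<close>

class topological_real_vector = real_vector + topological_ab_group_add +
  assumes tendsto_scaleR_nhds:
    "((\<lambda>p. fst p *\<^sub>R snd p) \<longlongrightarrow> a *\<^sub>R x) (nhds (a::real) \<times>\<^sub>F nhds x)"

instance real_normed_vector \<subseteq> topological_real_vector
proof
  fix a :: real and x :: 'a
  show "((\<lambda>p. fst p *\<^sub>R snd p) \<longlongrightarrow> a *\<^sub>R x) (nhds a \<times>\<^sub>F nhds x)"
    by (intro tendsto_scaleR filterlim_fst filterlim_snd)
qed

definition directed_set :: "'i set \<Rightarrow> 'i rel \<Rightarrow> bool" where
  "directed_set D r \<longleftrightarrow>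
     D \<noteq> {} \<and> preorder_on D r \<and> (\<forall>a\<in>D. \<forall>b\<in>D. \<exists>c\<in>D. (a, c) \<in> r \<and> (b, c) \<in> r)"

definition tails :: "'i set \<Rightarrow> 'i rel \<Rightarrow> 'i filter" where
  "tails D r = (INF a\<in>D. principal {b\<in>D. (a, b) \<in> r})"

lemma eventually_tails:
  assumes "directed_set D r"
  shows "eventually P (tails D r) \<longleftrightarrow> (\<exists>a\<in>D. \<forall>b\<in>D. (a, b) \<in> r \<longrightarrow> P b)"
  unfolding tails_def
proof (subst eventually_INF_base)
  show "D \<noteq> {}"
    using assms by (simp add: directed_set_def)
  have "trans r"
    using assms by (simp add: directed_set_def preorder_on_def)
  fix a b assume "a \<in> D" "b \<in> D"
  then obtain c where c: "c \<in> D" "(a, c) \<in> r" "(b, c) \<in> r"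
    using assms unfolding directed_set_def by blast
  have "{d\<in>D. (c, d) \<in> r} \<subseteq> {d\<in>D. (a, d) \<in> r} \<inter> {d\<in>D. (b, d) \<in> r}"
    using c \<open>trans r\<close> by (auto dest: transD)
  then show "\<exists>x\<in>D. principal {d\<in>D. (x, d) \<in> r}
      \<le> inf (principal {d\<in>D. (a, d) \<in> r}) (principal {d\<in>D. (b, d) \<in> r})"
    using c(1) by auto
qed (auto simp: eventually_principal)

text \<open>Convergence along \<open>tails D r\<close> is the usual convergence of nets:\<close>

lemma tendsto_tails_iff:
  assumes "directed_set D r"
  shows "(x \<longlongrightarrow> l) (tails D r) \<longleftrightarrow>
    (\<forall>U. open U \<longrightarrow> l \<in> U \<longrightarrow> (\<exists>a\<in>D. \<forall>b\<in>D. (a, b) \<in> r \<longrightarrow> x b \<in> U))"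
  by (simp add: tendsto_def eventually_tails[OF assms])

text \<open>A formula cannot quantify over types, so the type \<open>'i\<close> of the indices of the nets is a
  parameter, which each statement about \<open>a_usc\<close> quantifies universally. All directed sets
  within \<open>'i\<close> are considered. Functions on \<open>K\<close> are total functions of which
  only the values on \<open>K\<close> matter.\<close>

definition a_usc ::
  "'i itself \<Rightarrow> 'z::topological_real_vector set \<Rightarrow> 'x::topological_space set \<Rightarrow> ('x \<Rightarrow> 'z) \<Rightarrow> 'x \<Rightarrow> bool"
where
  "a_usc (_ :: 'i itself) C K h x0 \<longleftrightarrow>
     (\<forall>(D :: 'i set) r x.
        directed_set D r \<and> (\<forall>\<alpha>\<in>D. x \<alpha> \<in> K) \<and> (x \<longlongrightarrow> x0) (tails D r) \<longrightarrow>
        (\<exists>z l. (z \<longlongrightarrow> l) (tails D r) \<and>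
           (\<forall>\<alpha>\<in>D. h (x \<alpha>) - z \<alpha> \<in> uminus ` C) \<and> h x0 - l \<in> C))"

text \<open>For cones, the condition \<open>C + C = C\<close> is convexity in the usual sense:\<close>

lemma cone_add_self_iff_convex:
  assumes "cone C" "C \<noteq> {}"
  shows "C + C = C \<longleftrightarrow> convex C"
proof -
  have 0: "0 \<in> C"
    using assms by (simp add: cone_contains_0)
  have "C \<subseteq> C + C"
    using set_plus_intro[OF _ 0] by fastforce
  then have "C + C = C \<longleftrightarrow> (\<forall>x\<in>C. \<forall>y\<in>C. x + y \<in> C)"
    by (auto simp: set_plus_def)
  also have "\<dots> \<longleftrightarrow> convex C"
    using assms(1) convex_cone[of C] by (auto simp: cone_def)
  finally show ?thesis .
qed

end

theory Submission
  imports Defs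
begin

theorem mainTheorem3:
  fixes K :: "'x::t2_space set"
    and C :: "'z::{topological_real_vector, t2_space} set"
    and f g :: "'x \<Rightarrow> 'z"
    and x0 :: 'x
  assumes "cone C" and "C + C = C" and "C \<inter> uminus ` C = {0}" and "interior C \<noteq> {}"
    and "K \<noteq> {}" and "x0 \<in> K"
    and "a_usc TYPE('i) C K f x0" and "a_usc TYPE('i) C K g x0"
  shows "a_usc TYPE('i) C K (\<lambda>x. f x + g x) x0"
proof -
  have add: "a + b \<in> C" if "a \<in> C" "b \<in> C" for a b
    using set_plus_intro[OF that] assms(2) by simp
  show ?thesis
    unfolding a_usc_def
  proof (intro allI impI, elim conjE)
    fix D :: "'i set" and r x
    assume net: "directed_set D r" "\<forall>\<alpha>\<in>D. x \<alpha> \<in> K" "(x \<longlongrightarrow> x0) (tails D r)"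
    \<comment> \<open>Both bounding nets live on the index set \<open>D\<close> of the given net, so
      they can be added index by index.\<close>
    obtain u l where u: "(u \<longlongrightarrow> l) (tails D r)" "\<forall>\<alpha>\<in>D. f (x \<alpha>) - u \<alpha> \<in> uminus ` C" "f x0 - l \<in> C"
      using assms(7) net unfolding a_usc_def by blast
    obtain v m where v: "(v \<longlongrightarrow> m) (tails D r)" "\<forall>\<alpha>\<in>D. g (x \<alpha>) - v \<alpha> \<in> uminus ` C" "g x0 - m \<in> C"
      using assms(8) net unfolding a_usc_def by blast
    have "f (x \<alpha>) + g (x \<alpha>) - (u \<alpha> + v \<alpha>) \<in> uminus ` C" if mem: "\<alpha> \<in> D" for \<alpha>
    proof -
      obtain a b where ab: "a \<in> C" "b \<in> C" "f (x \<alpha>) - u \<alpha> = - a" "g (x \<alpha>) - v \<alpha> = - b"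
        using bspec[OF u(2) mem] bspec[OF v(2) mem] by (elim imageE) blast
      \<comment> \<open>\<open>add_diff_add\<close> regroups the left side as the sum of the two
        differences, each the negative of an element of \<open>C\<close>.\<close>
      have "f (x \<alpha>) + g (x \<alpha>) - (u \<alpha> + v \<alpha>) = - (a + b)"
        unfolding add_diff_add ab by simp
      then show ?thesis
        using add[OF ab(1,2)] by (rule image_eqI)
    qed
    moreover have "f x0 + g x0 - (l + m) \<in> C"
      unfolding add_diff_add using u(3) v(3) by (rule add)
    ultimately show "\<exists>z l. (z \<longlongrightarrow> l) (tails D r) \<and>
        (\<forall>\<alpha>\<in>D. f (x \<alpha>) + g (x \<alpha>) - z \<alpha> \<in> uminus ` C) \<and> f x0 + g x0 - l \<in> C"
      using tendsto_add[OF u(1) v(1)]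
      by (intro exI[of _ "\<lambda>\<alpha>. u \<alpha> + v \<alpha>"] exI[of _ "l + m"]) blast
  qed
qed

end
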